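(* Let $G$ be a weighted graph, and consider any computation of $q(G)$ represented by a rooted computation tree as described below, in which the leaf rule is applied only to graphs with no loops and no edges. Then the tree has at least $\frac{1}{2}\varepsilon(G)$ leaves. If moreover $G$ is simple (has no loops), then the tree has at least $\frac{1}{2}\gamma(G)$ leaves.
   Context: All graphs are finite and may have loops (at most one per vertex) but no multiple edges; $r$, $n$ denote rank and nullity over $GF(2)$ of the adjacency matrix (diagonal entry $1$ iff looped), $G[S]$ the induced subgraph. Let $A$ be a commutative ring with unity containing $x,y$; a weighted graph has $\alpha,\beta:V(G)\to A$ and $q(G)=\sum_{S\subseteq V(G)}(\prod_{s\in S}\alpha(s))(\prod_{v\notin S}\beta(v))(x-1)^{r(G[S])}(y-1)^{n(G[S])}$. The unweighted version $G^u$ has $\alpha\equiv\beta\equiv 1$; $q_N(G^u)=\sum_{S\subseteq V(G)}(y-1)^{n(G[S])}\in\mathbb{Z}[y]$, $\varepsilon(G)=q_N(G^u)$ evaluated at $y=0$, and $\gamma(G)$ is the coefficient of $y$ in $q_N(G^u)$. Local complement $G^a$: toggle adjacency $\{u,w\}$ for all neighbors $u,w$ of $a$ distinct from $a$, including $u=w$. Pivot $G^{ab}$ ($a\ne b$): toggle $\{u,w\}$ for all $u,w\notin\{a,b\}$ with $u$ adjacent to $a$, $w$ adjacent to $b$, and $u$ not adjacent to $b$ or $w$ not adjacent to $a$. Operations keep weights unless stated. Computation tree: each node is labeled by a weighted graph, the root by $G$; at a node labeled $H$ one of the following is applied: (i) $a$ looped: children $H-a$ and $H^{a}-a$ (from $q(H)=\beta(a)q(H-a)+\alpha(a)(x-1)q(H^a-a)$);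 (ii) $a,b$ adjacent unlooped: children $H-a$, $H^{ab}-b$, $H^{ab}-a-b$ (from $q(H)=\beta(a)q(H-a)+\beta(b)q(H^{ab}-b)+(\alpha(a)\alpha(b)(x-1)^2-\beta(a)\beta(b))q(H^{ab}-a-b)$); (iii) $a,b$ adjacent unlooped: children $H-a$ and $(H^{ab}-b)'$, where $a$ gets weights $\alpha'(a)=\beta(b)$, $\beta'(a)=\alpha(b)(x-1)^2$; (iv) $a,b$ identical twins (both looped and adjacent, or both unlooped and nonadjacent, same neighbors outside $\{a,b\}$): single child $H-b$ with $\beta'(a)=\beta(a)\beta(b)$, $\alpha'(a)=\alpha(a)\beta(b)+\alpha(a)\alpha(b)(y-1)+\beta(a)\alpha(b)$; (v) $b$ unlooped of degree one with neighbor $a$: single child $H-b$ with $\alpha'(a)=\alpha(a)\beta(b)$, $\beta'(a)=\alpha(a)\alpha(b)(x-1)^2+\beta(a)\alpha(b)(y-1)+\beta(a)\beta(b)$; (vi) leaf: $H$ has no edges and no loops, and $q(H)=\prod_{v}(\alpha(v)(y-1)+\beta(v))$ is evaluated directly. *)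

theory Defs
  imports
    Complex_Main
    "HOL-Library.Z2"
    "HOL-Library.Function_Algebras"
    "HOL-Computational_Algebra.Polynomial"
begin

text \<open>
  Vectors over GF(2) are functions into \<^typ>\<open>bit\<close>; those indexed by a vertex set are
  extended by 0 outside of it.
\<close>

global_interpretation gf2: vector_space "\<lambda>(c::bit) (f::'v \<Rightarrow> bit) v. c * f v"
  by unfold_locales (auto simp: fun_eq_iff algebra_simps)

record 'v graph =
  verts :: "'v set"
  adj :: "'v \<Rightarrow> 'v \<Rightarrow> bool"

text \<open>A loop at \<^term>\<open>v\<close> is encoded as \<^term>\<open>adj G v v\<close>.\<close>

definition graph :: "('v, 'm) graph_scheme \<Rightarrow> bool" where
  "graph G \<longleftrightarrow> finite (verts G)
     \<and> (\<forall>u w. adj G u w \<longrightarrow> u \<in> verts G \<and> w \<in> verts G)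
     \<and> (\<forall>u w. adj G u w \<longrightarrow> adj G w u)"

definition simple :: "('v, 'm) graph_scheme \<Rightarrow> bool" where
  "simple G \<longleftrightarrow> (\<forall>v\<in>verts G. \<not> adj G v v)"

definition edgeless :: "('v, 'm) graph_scheme \<Rightarrow> bool" where
  "edgeless G \<longleftrightarrow> (\<forall>u\<in>verts G. \<forall>w\<in>verts G. \<not> adj G u w)"

definition induced :: "('v, 'm) graph_scheme \<Rightarrow> 'v set \<Rightarrow> ('v, 'm) graph_scheme" where
  "induced G S = G\<lparr>verts := S, adj := \<lambda>u w. adj G u w \<and> u \<in> S \<and> w \<in> S\<rparr>"

definition del_vert :: "('v, 'm) graph_scheme \<Rightarrow> 'v \<Rightarrow> ('v, 'm) graph_scheme" where
  "del_vert G a = induced G (verts G - {a})"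

definition adj_matrix :: "('v, 'm) graph_scheme \<Rightarrow> 'v \<Rightarrow> 'v \<Rightarrow> bit" where
  "adj_matrix G v w = (if v \<in> verts G \<and> w \<in> verts G \<and> adj G v w then 1 else 0)"

definition gf2_rank :: "('v, 'm) graph_scheme \<Rightarrow> nat" where
  "gf2_rank G = gf2.dim (adj_matrix G ` verts G)"

definition gf2_kernel :: "('v, 'm) graph_scheme \<Rightarrow> ('v \<Rightarrow> bit) set" where
  "gf2_kernel G = {f. (\<forall>v. v \<notin> verts G \<longrightarrow> f v = 0)
     \<and> (\<forall>v\<in>verts G. (\<Sum>w\<in>verts G. adj_matrix G v w * f w) = 0)}"

definition gf2_nullity :: "('v, 'm) graph_scheme \<Rightarrow> nat" where
  "gf2_nullity G = gf2.dim (gf2_kernel G)"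

definition local_comp :: "('v, 'm) graph_scheme \<Rightarrow> 'v \<Rightarrow> ('v, 'm) graph_scheme" where
  "local_comp G a = G\<lparr>adj := \<lambda>u w.
     adj G u w \<noteq> (u \<noteq> a \<and> w \<noteq> a \<and> adj G u a \<and> adj G w a)\<rparr>"

text \<open>
  Pairs toggled by a pivot are unordered, so either order of \<^term>\<open>u\<close> and \<^term>\<open>w\<close> may
  witness the condition; no pair satisfies it in both orders.
\<close>

definition pivot_pair :: "('v, 'm) graph_scheme \<Rightarrow> 'v \<Rightarrow> 'v \<Rightarrow> 'v \<Rightarrow> 'v \<Rightarrow> bool" where
  "pivot_pair G a b u w \<longleftrightarrow> u \<notin> {a, b} \<and> w \<notin> {a, b} \<and> adj G u a \<and> adj G w b
     \<and> (\<not> adj G u b \<or> \<not> adj G w a)"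

definition pivot :: "('v, 'm) graph_scheme \<Rightarrow> 'v \<Rightarrow> 'v \<Rightarrow> ('v, 'm) graph_scheme" where
  "pivot G a b = G\<lparr>adj := \<lambda>u w.
     adj G u w \<noteq> (pivot_pair G a b u w \<or> pivot_pair G a b w u)\<rparr>"

definition adjacent_unlooped :: "('v, 'm) graph_scheme \<Rightarrow> 'v \<Rightarrow> 'v \<Rightarrow> bool" where
  "adjacent_unlooped G a b \<longleftrightarrow> a \<in> verts G \<and> b \<in> verts G \<and> a \<noteq> b
     \<and> adj G a b \<and> \<not> adj G a a \<and> \<not> adj G b b"

definition identical_twins :: "('v, 'm) graph_scheme \<Rightarrow> 'v \<Rightarrow> 'v \<Rightarrow> bool" where
  "identical_twins G a b \<longleftrightarrow> a \<in> verts G \<and> b \<in> verts G \<and> a \<noteq> b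
     \<and> ((adj G a a \<and> adj G b b \<and> adj G a b) \<or> (\<not> adj G a a \<and> \<not> adj G b b \<and> \<not> adj G a b))
     \<and> (\<forall>w \<in> verts G - {a, b}. adj G a w \<longleftrightarrow> adj G b w)"

definition pendant :: "('v, 'm) graph_scheme \<Rightarrow> 'v \<Rightarrow> 'v \<Rightarrow> bool" where
  "pendant G b a \<longleftrightarrow> b \<in> verts G \<and> \<not> adj G b b \<and> {w \<in> verts G. adj G b w} = {a}"

text \<open>
  The values of the weights outside the vertex set are irrelevant. The sort used for weight
  rings is that of commutative rings with unity, including the zero ring, which
  \<^class>\<open>comm_ring_1\<close> excludes.
\<close>

record ('v, 'r) wgraph = "'v graph" +
  alpha :: "'v \<Rightarrow> 'r"
  beta :: "'v \<Rightarrow> 'r"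

definition reweight :: "('v, 'r) wgraph \<Rightarrow> 'v \<Rightarrow> 'r \<Rightarrow> 'r \<Rightarrow> ('v, 'r) wgraph" where
  "reweight G a p q = G\<lparr>alpha := (alpha G)(a := p), beta := (beta G)(a := q)\<rparr>"

definition interlace ::
    "'r \<Rightarrow> 'r \<Rightarrow> ('v, 'r::{comm_ring, comm_monoid_mult}) wgraph \<Rightarrow> 'r" where
  "interlace x y G = (\<Sum>S\<in>Pow (verts G). (\<Prod>s\<in>S. alpha G s) * (\<Prod>v\<in>verts G - S. beta G v)
     * (x - 1) ^ gf2_rank (induced G S) * (y - 1) ^ gf2_nullity (induced G S))"

text \<open>
  The vertex-nullity polynomial does not look at the weights, so for a weighted graph it is the
  polynomial of its unweighted version. The indeterminate is \<^term>\<open>[:0, 1:] :: int poly\<close>.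
\<close>

definition vertex_nullity_poly :: "('v, 'm) graph_scheme \<Rightarrow> int poly" where
  "vertex_nullity_poly G = (\<Sum>S\<in>Pow (verts G). ([:0, 1:] - 1) ^ gf2_nullity (induced G S))"

definition unweighted :: "('v, 'm) graph_scheme \<Rightarrow> ('v, int poly) wgraph" where
  "unweighted G = \<lparr>verts = verts G, adj = adj G, alpha = \<lambda>_. 1, beta = \<lambda>_. 1\<rparr>"

lemma gf2_nullity_cong:
  assumes "verts G = verts H" "adj G = adj H"
  shows "gf2_nullity G = gf2_nullity H"
  using assms by (simp add: gf2_nullity_def gf2_kernel_def adj_matrix_def)

lemma vertex_nullity_poly_eq_interlace:
  "vertex_nullity_poly G = interlace 2 [:0, 1:] (unweighted G)"
  unfolding vertex_nullity_poly_def interlace_def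
  by (auto simp: unweighted_def induced_def intro!: sum.cong arg_cong2[where f = "(^)"]
      gf2_nullity_cong)

definition epsilon :: "('v, 'm) graph_scheme \<Rightarrow> int" where
  "epsilon G = poly (vertex_nullity_poly G) 0"

definition gamma :: "('v, 'm) graph_scheme \<Rightarrow> int" where
  "gamma G = coeff (vertex_nullity_poly G) 1"

datatype 'l tree = Node (root: 'l) "'l tree list"

fun leaves :: "'l tree \<Rightarrow> nat" where
  "leaves (Node l ts) = (if ts = [] then 1 else sum_list (map leaves ts))"

inductive computation_tree ::
    "'r \<Rightarrow> 'r \<Rightarrow> ('v, 'r::{comm_ring, comm_monoid_mult}) wgraph tree \<Rightarrow> bool"
  for x y :: 'r where
  loop: "a \<in> verts H \<Longrightarrow> adj H a a \<Longrightarrow>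
    computation_tree x y S \<Longrightarrow> root S = del_vert H a \<Longrightarrow>
    computation_tree x y T \<Longrightarrow> root T = del_vert (local_comp H a) a \<Longrightarrow>
    computation_tree x y (Node H [S, T])"
| edge3: "adjacent_unlooped H a b \<Longrightarrow>
    computation_tree x y S \<Longrightarrow> root S = del_vert H a \<Longrightarrow>
    computation_tree x y T \<Longrightarrow> root T = del_vert (pivot H a b) b \<Longrightarrow>
    computation_tree x y U \<Longrightarrow> root U = del_vert (del_vert (pivot H a b) a) b \<Longrightarrow>
    computation_tree x y (Node H [S, T, U])"
| edge2: "adjacent_unlooped H a b \<Longrightarrow>
    computation_tree x y S \<Longrightarrow> root S = del_vert H a \<Longrightarrow>
    computation_tree x y T \<Longrightarrow>
    root T = reweight (del_vert (pivot H a b) b) a (beta H b) (alpha H b * (x - 1)\<^sup>2) \<Longrightarrow>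
    computation_tree x y (Node H [S, T])"
| twins: "identical_twins H a b \<Longrightarrow>
    computation_tree x y T \<Longrightarrow>
    root T = reweight (del_vert H b) a
      (alpha H a * beta H b + alpha H a * alpha H b * (y - 1) + beta H a * alpha H b)
      (beta H a * beta H b) \<Longrightarrow>
    computation_tree x y (Node H [T])"
| pendant: "pendant H b a \<Longrightarrow>
    computation_tree x y T \<Longrightarrow>
    root T = reweight (del_vert H b) a
      (alpha H a * beta H b)
      (alpha H a * alpha H b * (x - 1)\<^sup>2 + beta H a * alpha H b * (y - 1) + beta H a * beta H b) \<Longrightarrow>
    computation_tree x y (Node H [T])"
| leaf: "edgeless H \<Longrightarrow> computation_tree x y (Node H [])"

end

theory Submission
  imports Defs
begin

text \<open>
  The vertex-nullity polynomial \<open>q\<^sub>N\<close> obeys the same recurrences as \<open>q\<close>, with all weights and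
  \<open>x - 1\<close> specialised to 1: it is additive over the two children in the loop rule and over the
  first two children in the edge rules; the twin rule contributes
  \<open>q\<^sub>N(H) = q\<^sub>N(H - b) + y (q\<^sub>N(H - b) - q\<^sub>N(H - a - b))\<close> and the pendant rule
  \<open>q\<^sub>N(H) = q\<^sub>N(H - b) + y q\<^sub>N(H - a - b)\<close>. At \<open>y = 0\<close> this makes \<open>\<epsilon>\<close> at most additive along the tree,
  and it is at most 1 at the leaves, so \<open>\<epsilon>\<close> is bounded by the number of leaves. For simple graphs
  \<open>\<epsilon>\<close> vanishes unless the graph is empty; so the pendant rule increases \<open>\<gamma>\<close> only when \<open>H\<close> is a
  single edge, where \<open>\<gamma> = 2\<close>, and the twin rule never does. Hence \<open>\<gamma>\<close> is at most twice the number
  of leaves.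

  The recurrences come from bijections between kernels over GF(2), nullities being read off from
  the number of kernel elements.
\<close>


text \<open>These default rules turn the field operations of \<^typ>\<open>bit\<close> into bit operations and parities.\<close>

declare add_bit_eq_xor [simp del] mult_bit_eq_and [simp del] minus_bit_def [simp del]

section \<open>Null spaces over GF(2) and counting their elements\<close>

text \<open>An entry of a matrix-vector product. The index \<open>v\<close> may lie outside
  \<open>S\<close>, so the equation of a vertex that has been split off can still be evaluated on
  the remaining vertices.\<close>

definition row :: "('v \<Rightarrow> 'v \<Rightarrow> bool) \<Rightarrow> 'v set \<Rightarrow> ('v \<Rightarrow> bit) \<Rightarrow> 'v \<Rightarrow> bit" where
  "row E S f v = (\<Sum>w\<in>S. of_bool (E v w) * f w)"

text \<open>Relation and vertex set are separate arguments, so all induced subgraphs of a graph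
  share one relation and vertices are added by \<open>insert\<close>.\<close>

definition null_space :: "('v \<Rightarrow> 'v \<Rightarrow> bool) \<Rightarrow> 'v set \<Rightarrow> ('v \<Rightarrow> bit) set" where
  "null_space E S = {f. (\<forall>v. v \<notin> S \<longrightarrow> f v = 0) \<and> (\<forall>v\<in>S. row E S f v = 0)}"

definition nullity :: "('v \<Rightarrow> 'v \<Rightarrow> bool) \<Rightarrow> 'v set \<Rightarrow> nat" where
  "nullity E S = gf2.dim (null_space E S)"

lemma row_cong:
  assumes "\<And>w. w \<in> S \<Longrightarrow> E v w \<longleftrightarrow> E' v w" and "\<And>w. w \<in> S \<Longrightarrow> f w = g w"
  shows "row E S f v = row E' S g v"
  unfolding row_def by (rule sum.cong) (use assms in auto)

lemma null_space_cong:
  assumes "\<And>v w. v \<in> S \<Longrightarrow> w \<in> S \<Longrightarrow> E v w \<longleftrightarrow> E' v w"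
  shows "null_space E S = null_space E' S"
  using assms row_cong[of S E _ E'] unfolding null_space_def by auto

lemma nullity_cong:
  assumes "\<And>v w. v \<in> S \<Longrightarrow> w \<in> S \<Longrightarrow> E v w \<longleftrightarrow> E' v w"
  shows "nullity E S = nullity E' S"
  unfolding nullity_def using assms by (subst null_space_cong) auto

lemma row_insert:
  "finite S \<Longrightarrow> a \<notin> S \<Longrightarrow> row E (insert a S) f v = of_bool (E v a) * f a + row E S f v"
  by (simp add: row_def)

lemma row_upd: "a \<notin> S \<Longrightarrow> row E S (f(a := c)) v = row E S f v"
  by (rule row_cong) auto

lemma row_add: "row E S (\<lambda>w. f w + g w) v = row E S f v + row E S g v"
  unfolding row_def by (simp add: distrib_left sum.distrib)

lemma row_scale: "row E S (\<lambda>w. c * f w) v = c * row E S f v"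
  unfolding row_def
  by (simp add: sum_distrib_left mult.left_commute)

lemma gf2_nullity_induced: "gf2_nullity (induced G S) = nullity (adj G) S"
proof -
  have "gf2_kernel (induced G S) = null_space (adj G) S"
    unfolding gf2_kernel_def null_space_def row_def induced_def adj_matrix_def
    by (auto intro!: sum.cong)
      (auto intro!: sum.cong simp: of_bool_def)
  then show ?thesis
    by (simp add: gf2_nullity_def nullity_def)
qed

lemma subspace_null_space: "gf2.subspace (null_space E S)"
proof (rule gf2.subspaceI)
  show "0 \<in> null_space E S"
    by (auto simp: null_space_def row_def)
next
  fix f g assume fg: "f \<in> null_space E S" "g \<in> null_space E S"
  have "f + g = (\<lambda>w. f w + g w)"
    by (simp add: fun_eq_iff)
  with fg show "f + g \<in> null_space E S"
    by (simp add: null_space_def row_add)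
next
  fix c :: bit and f assume "f \<in> null_space E S"
  then show "(\<lambda>v. c * f v) \<in> null_space E S"
    by (simp add: null_space_def row_scale)
qed

lemma finite_null_space:
  assumes "finite S"
  shows "finite (null_space E S)"
proof (rule finite_subset)
  \<comment> \<open>A vector over GF(2) supported in \<open>S\<close> is the indicator function of a
    subset of \<open>S\<close>.\<close>
  show "null_space E S \<subseteq> (\<lambda>A v. of_bool (v \<in> A)) ` Pow S"
  proof
    fix f assume "f \<in> null_space E S"
    then have "{v. f v = 1} \<subseteq> S"
      by (auto simp: null_space_def simp flip: bit_not_zero_iff)
    moreover have "f = (\<lambda>v. of_bool (v \<in> {v. f v = 1}))"
      by (auto simp: fun_eq_iff of_bool_def)
    ultimately show "f \<in> (\<lambda>A v. of_bool (v \<in> A)) ` Pow S"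
      by blast
  qed
  show "finite ((\<lambda>A v. of_bool (v \<in> A)) ` Pow S)"
    using assms by simp
qed

text \<open>The only scalars are 0 and 1, so each new basis vector \<open>b\<close> adds one
  translate of the old span, disjoint from it, and doubles the count.\<close>

lemma card_span_independent:
  assumes "finite B" "gf2.independent B"
  shows "finite (gf2.span B) \<and> card (gf2.span B) = 2 ^ card B"
  using assms
proof (induction B)
  case empty
  then show ?case by simp
next
  case (insert b B)
  then have b: "b \<notin> gf2.span B" and "gf2.independent B"
    by (auto simp: gf2.independent_insert)
  then have IH: "finite (gf2.span B)" "card (gf2.span B) = 2 ^ card B"
    using insert.IH by auto
  have ex_bit: "(\<exists>k. P k) \<longleftrightarrow> P 0 \<or> P 1" for P :: "bit \<Rightarrow> bool"
    by (metis bit.exhaust)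
  have span: "gf2.span (insert b B) = gf2.span B \<union> (\<lambda>f. f + b) ` gf2.span B"
  proof -
    have "f \<in> gf2.span (insert b B) \<longleftrightarrow> f \<in> gf2.span B \<or> f - b \<in> gf2.span B" for f
      by (simp add: gf2.span_breakdown_eq ex_bit fun_diff_def)
    moreover have "f - b \<in> gf2.span B \<longleftrightarrow> f \<in> (\<lambda>f. f + b) ` gf2.span B" for f
      by (metis (no_types, lifting) add_diff_cancel diff_add_cancel image_iff)
    ultimately show ?thesis by blast
  qed
  \<comment> \<open>A common element of the old span and its translate would put \<open>b\<close>
    into the old span.\<close>
  have "b \<in> gf2.span B" if "f \<in> gf2.span B" "f + b \<in> gf2.span B" for f
    using gf2.span_diff[OF that(2,1)] by simp
  then have "gf2.span B \<inter> (\<lambda>f. f + b) ` gf2.span B = {}"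
    using b by auto
  then have "card (gf2.span (insert b B)) = card (gf2.span B) + card ((\<lambda>f. f + b) ` gf2.span B)"
    unfolding span using IH by (simp add: card_Un_disjoint)
  also have "card ((\<lambda>f. f + b) ` gf2.span B) = card (gf2.span B)"
    by (rule card_image) (simp add: inj_on_def)
  finally show ?case
    using insert.hyps IH span by simp
qed

text \<open>A null space is a subspace, hence the span of a basis. Nullities can therefore be
  compared through bijections whose linearity is never checked.\<close>

lemma card_null_space:
  assumes "finite S"
  shows "card (null_space E S) = 2 ^ nullity E S"
proof -
  obtain B where B: "B \<subseteq> null_space E S" "gf2.independent B" "null_space E S \<subseteq> gf2.span B"
      "card B = gf2.dim (null_space E S)"
    using gf2.basis_exists by blast
  then have "null_space E S = gf2.span B"
    using gf2.span_minimal[OF _ subspace_null_space] by blast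
  moreover have "finite B"
    using B(1) finite_null_space[OF assms] finite_subset by blast
  ultimately show ?thesis
    using card_span_independent[of B] B unfolding nullity_def by metis
qed

lemma nullity_empty: "nullity E {} = 0"
proof -
  have "null_space E {} = {\<lambda>_. 0}" by (auto simp: null_space_def)
  then have "2 ^ nullity E {} = (2 :: nat) ^ 0"
    using card_null_space[of "{}" E] by simp
  then show ?thesis by (simp del: power_0)
qed

lemma nullity_eqI:
  assumes "finite S" "finite S'" "bij_betw \<phi> (null_space E S) (null_space E' S')"
  shows "nullity E S = nullity E' S'"
  using bij_betw_same_card[OF assms(3)] assms(1,2) by (simp add: card_null_space)

text \<open>The factor \<open>UNIV\<close> stands for one free coordinate, which doubles the number
  of solutions.\<close>

lemma nullity_SucI:
  assumes "finite S" "finite S'"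
    and "bij_betw \<phi> (null_space E S) (null_space E' S' \<times> (UNIV :: bit set))"
  shows "nullity E S = Suc (nullity E' S')"
proof -
  have "(UNIV :: bit set) = {0, 1}"
    by (auto intro: bit.exhaust)
  then have "card (UNIV :: bit set) = 2" by (simp only: card_2_iff) auto
  then have "2 ^ nullity E S = (2 :: nat) ^ Suc (nullity E' S')"
    using bij_betw_same_card[OF assms(3)] assms(1,2)
    by (simp add: card_null_space card_cartesian_product)
  then show ?thesis by (simp del: power_Suc)
qed

section \<open>Nullity under local complements, pivots, twins and pendant vertices\<close>

lemma bit_add_cancel: "x + x = 0" "x + (x + y) = y" for x y :: bit
  by (cases x; cases y; simp)+

lemma bit_add_eq_0_iff: "x + y = 0 \<longleftrightarrow> x = y" for x y :: bit
  by (cases x; cases y; simp)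

text \<open>
  The matrix of \<open>E'\<close> on \<open>S\<close> is the Schur complement of the block of \<open>E\<close> on \<open>a\<close> (here) or on
  \<open>a, b\<close> (in \<open>nullity_pivot_both\<close>); in \<open>nullity_pivot_one\<close> the two matrices are congruent.
\<close>

lemma nullity_local_comp:
  assumes S: "finite S" "a \<notin> S" and "symp E" "E a a"
    and E': "\<And>v w. v \<in> S \<Longrightarrow> w \<in> S \<Longrightarrow> E' v w \<longleftrightarrow> E v w \<noteq> (E v a \<and> E w a)"
  shows "nullity E (insert a S) = nullity E' S"
proof (rule nullity_eqI)
  have sym: "E v a \<longleftrightarrow> E a v" for v using \<open>symp E\<close> by (auto dest: sympD)
  have row': "row E' S f v = row E S f v + of_bool (E v a) * row E S f a" if "v \<in> S" for f v
    unfolding row_def sum_distrib_left sum.distrib[symmetric]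
    by (rule sum.cong) (use that E' sym in auto)
  \<comment> \<open>Since \<open>a\<close> is looped, its equation reads
    \<open>f a + row E S f a = 0\<close>; this determines \<open>f a\<close> from the other
    coordinates and supplies the inverse map.\<close>
  show "bij_betw (\<lambda>f. f(a := 0)) (null_space E (insert a S)) (null_space E' S)"
  proof (rule bij_betw_byWitness[where f' = "\<lambda>f. f(a := row E S f a)"])
    show "\<forall>f\<in>null_space E (insert a S). (f(a := 0))(a := row E S (f(a := 0)) a) = f"
      using S \<open>E a a\<close> by (auto simp: null_space_def row_insert row_upd bit_add_cancel bit_add_eq_0_iff fun_eq_iff)
    show "\<forall>f\<in>null_space E' S. (f(a := row E S f a))(a := 0) = f"
      using S by (auto simp: null_space_def fun_eq_iff)
    show "(\<lambda>f. f(a := 0)) ` null_space E (insert a S) \<subseteq> null_space E' S"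
      using S \<open>E a a\<close> by (auto simp: null_space_def row_insert row_upd row' bit_add_cancel bit_add_eq_0_iff)
    show "(\<lambda>f. f(a := row E S f a)) ` null_space E' S \<subseteq> null_space E (insert a S)"
      using S \<open>E a a\<close> by (auto simp: null_space_def row_insert row_upd row' bit_add_cancel bit_add_eq_0_iff)
  qed
qed (use S in auto)

text \<open>Over GF(2) the toggled entry is the rank-two update
  \<open>E v a * E b w + E v b * E a w\<close>. Summing over \<open>w\<close> turns it into
  multiples of the rows of \<open>b\<close> and \<open>a\<close>.\<close>

lemma row_pivot:
  assumes "symp E"
    and "\<And>w. w \<in> S \<Longrightarrow> E' v w \<longleftrightarrow> E v w \<noteq> ((E v a \<and> E w b) \<noteq> (E v b \<and> E w a))"
  shows "row E' S f v = row E S f v + of_bool (E v a) * row E S f b + of_bool (E v b) * row E S f a"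
proof -
  have "E w c \<longleftrightarrow> E c w" for w c using \<open>symp E\<close> by (auto dest: sympD)
  then show ?thesis
    unfolding row_def sum_distrib_left sum.distrib[symmetric]
    by (intro sum.cong) (use assms(2) in auto)
qed

lemma nullity_pivot_both:
  assumes S: "finite S" "a \<notin> S" "b \<notin> S" and "symp E"
    and ab: "a \<noteq> b" "E a b" "\<not> E a a" "\<not> E b b"
    and E': "\<And>v w. v \<in> S \<Longrightarrow> w \<in> S \<Longrightarrow>
      E' v w \<longleftrightarrow> E v w \<noteq> ((E v a \<and> E w b) \<noteq> (E v b \<and> E w a))"
  shows "nullity E (insert a (insert b S)) = nullity E' S"
proof (rule nullity_eqI)
  have ba: "E b a" using \<open>symp E\<close> ab by (auto dest: sympD)
  have row': "row E' S f v = row E S f v + of_bool (E v a) * row E S f b + of_bool (E v b) * row E S f a"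
    if "v \<in> S" for f v
    by (rule row_pivot[OF \<open>symp E\<close>]) (rule E'[OF that])
  \<comment> \<open>The block on \<open>a, b\<close> has zero diagonal and ones elsewhere, so the
    equation at \<open>b\<close> yields \<open>f a\<close> and the one at \<open>a\<close> yields
    \<open>f b\<close>. Substituting both into the remaining equations produces the rows of
    \<open>E'\<close>.\<close>
  have mem: "f \<in> null_space E (insert a (insert b S)) \<longleftrightarrow>
      f a = row E S f b \<and> f b = row E S f a \<and>
      (\<forall>v. v \<notin> insert a (insert b S) \<longrightarrow> f v = 0) \<and> (\<forall>v\<in>S. row E' S f v = 0)"
    (is "?l \<longleftrightarrow> ?r") for f
  proof -
    have "?l \<longleftrightarrow> f a + row E S f b = 0 \<and> f b + row E S f a = 0 \<and>
      (\<forall>v. v \<notin> insert a (insert b S) \<longrightarrow> f v = 0) \<and>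
      (\<forall>v\<in>S. of_bool (E v a) * f a + (of_bool (E v b) * f b + row E S f v) = 0)"
      using S ab ba by (auto simp: null_space_def row_insert)
    also have "\<dots> \<longleftrightarrow> f a = row E S f b \<and> f b = row E S f a \<and>
      (\<forall>v. v \<notin> insert a (insert b S) \<longrightarrow> f v = 0) \<and>
      (\<forall>v\<in>S. of_bool (E v a) * row E S f b + (of_bool (E v b) * row E S f a + row E S f v) = 0)"
      unfolding bit_add_eq_0_iff by metis
    also have "\<dots> \<longleftrightarrow> ?r"
      by (simp add: row' ac_simps)
    finally show ?thesis .
  qed
  have mem': "f \<in> null_space E' S \<Longrightarrow> f a = 0 \<and> f b = 0" for f
    using S by (simp add: null_space_def)
  show "bij_betw (\<lambda>f. f(a := 0, b := 0)) (null_space E (insert a (insert b S))) (null_space E' S)"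
  proof (rule bij_betw_byWitness[where f' = "\<lambda>f. f(a := row E S f b, b := row E S f a)"])
    show "\<forall>f\<in>null_space E (insert a (insert b S)).
        (f(a := 0, b := 0))(a := row E S (f(a := 0, b := 0)) b, b := row E S (f(a := 0, b := 0)) a) = f"
      using S ab by (simp add: mem row_upd fun_eq_iff)
    show "\<forall>f\<in>null_space E' S. (f(a := row E S f b, b := row E S f a))(a := 0, b := 0) = f"
      using mem' by (simp add: fun_eq_iff)
    show "(\<lambda>f. f(a := 0, b := 0)) ` null_space E (insert a (insert b S)) \<subseteq> null_space E' S"
      using S by (auto simp: mem) (auto simp: null_space_def row_upd)
    show "(\<lambda>f. f(a := row E S f b, b := row E S f a)) ` null_space E' S
        \<subseteq> null_space E (insert a (insert b S))"
      using S ab by (auto simp: mem row_upd) (auto simp: null_space_def)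
  qed
qed (use S in auto)

lemma nullity_pivot_one:
  assumes S: "finite S" "a \<notin> S" "b \<notin> S" and "symp E"
    and ab: "a \<noteq> b" "E a b" "\<not> E a a" "\<not> E b b"
    and E': "\<And>v w. v \<in> S \<Longrightarrow> w \<in> S \<Longrightarrow>
      E' v w \<longleftrightarrow> E v w \<noteq> ((E v a \<and> E w b) \<noteq> (E v b \<and> E w a))"
    and E'a: "\<And>v. v \<in> insert a S \<Longrightarrow> E' a v \<longleftrightarrow> E a v" "\<And>v. v \<in> insert a S \<Longrightarrow> E' v a \<longleftrightarrow> E v a"
  shows "nullity E (insert a S) = nullity E' (insert a S)"
proof (rule nullity_eqI)
  note row' = row_pivot[OF \<open>symp E\<close> E']
  have row'_a: "row E' S f a = row E S f a" for f
    by (rule row_cong) (use E'a in auto)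
  note simps = null_space_def row_insert row_upd row' row'_a E'a bit_add_cancel bit_add_eq_0_iff
  \<comment> \<open>In the row of \<open>v\<close> under \<open>E'\<close>, the term
    \<open>of_bool (E v b) * row E S f a\<close> vanishes by the equation at \<open>a\<close>, and
    \<open>of_bool (E v a) * row E S f b\<close> is absorbed by this shift of \<open>f a\<close>.
    The map is an involution because \<open>row E S f b\<close> does not involve coordinate
    \<open>a\<close>.\<close>
  let ?\<phi> = "\<lambda>f. f(a := f a + row E S f b)"
  show "bij_betw ?\<phi> (null_space E (insert a S)) (null_space E' (insert a S))"
  proof (rule bij_betw_byWitness[where f' = ?\<phi>])
    show "\<forall>f\<in>null_space E (insert a S). ?\<phi> (?\<phi> f) = f" "\<forall>f\<in>null_space E' (insert a S). ?\<phi> (?\<phi> f) = f"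
      using S by (auto simp: row_upd bit_add_cancel bit_add_eq_0_iff fun_eq_iff)
    show "?\<phi> ` null_space E (insert a S) \<subseteq> null_space E' (insert a S)"
      using S ab by (auto simp: simps)
    show "?\<phi> ` null_space E' (insert a S) \<subseteq> null_space E (insert a S)"
      using S ab by (auto simp: simps)
  qed
qed (use S in auto)

text \<open>Replacing \<open>b\<close> by its twin is an isomorphism of induced subgraphs; a
  solution follows by moving its coordinate at \<open>b\<close> to \<open>a\<close>.\<close>

lemma nullity_twin_swap:
  assumes S: "finite S" "a \<notin> S" "b \<notin> S" and "a \<noteq> b" "E a a \<longleftrightarrow> E b b"
    and ab: "\<And>w. w \<in> S \<Longrightarrow> E a w \<longleftrightarrow> E b w" "\<And>w. w \<in> S \<Longrightarrow> E w a \<longleftrightarrow> E w b"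
  shows "nullity E (insert b S) = nullity E (insert a S)"
proof (rule nullity_eqI)
  have row_ab: "row E S f a = row E S f b" for f
    unfolding row_def by (rule sum.cong) (use ab in auto)
  show "bij_betw (\<lambda>f. f(a := f b, b := 0)) (null_space E (insert b S)) (null_space E (insert a S))"
    by (rule bij_betw_byWitness[where f' = "\<lambda>f. f(b := f a, a := 0)"])
      (use S \<open>a \<noteq> b\<close> in \<open>auto simp: null_space_def row_insert row_upd row_ab ab assms(5) fun_eq_iff\<close>)
qed (use S in auto)

text \<open>The columns of \<open>a\<close> and \<open>b\<close> coincide, so the equations see only
  \<open>f a + f b\<close>; the rows coincide too, so \<open>b\<close> adds no new equation. Thus
  \<open>f b\<close> is free.\<close>

lemma nullity_twins:
  assumes S: "finite S" "a \<notin> S" "b \<notin> S"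
    and "a \<noteq> b" "E a a \<longleftrightarrow> E a b" "E b a \<longleftrightarrow> E a b" "E b b \<longleftrightarrow> E a b"
    and ab: "\<And>w. w \<in> S \<Longrightarrow> E a w \<longleftrightarrow> E b w" "\<And>w. w \<in> S \<Longrightarrow> E w a \<longleftrightarrow> E w b"
  shows "nullity E (insert a (insert b S)) = Suc (nullity E (insert a S))"
proof (rule nullity_SucI)
  have row_ab: "row E S f a = row E S f b" for f
    unfolding row_def by (rule sum.cong) (use ab in auto)
  have rows: "row E (insert a (insert b S)) f v = row E (insert a S) (f(a := f a + f b, b := 0)) v"
    if "v \<in> insert a (insert b S)" for f v
    using that S assms(4-7) by (auto simp: row_insert row_upd ab add.assoc)
  have row_b: "row E (insert a S) f b = row E (insert a S) f a" for f
    using S assms(4-7) by (simp add: row_insert row_ab)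
  let ?\<phi> = "\<lambda>f. (f(a := f a + f b, b := 0), f b)" and ?\<psi> = "\<lambda>(f, c). f(a := f a + c, b := c)"
  \<comment> \<open>Here \<open>f b = 0\<close> because \<open>b\<close> lies outside the support
    set, and \<open>c + c = 0\<close>.\<close>
  have inv: "f \<in> null_space E (insert a S) \<Longrightarrow>
      (f(a := f a + c, b := c))(a := f a + c + c, b := 0) = f" for f c
    using S \<open>a \<noteq> b\<close> by (auto simp: null_space_def fun_eq_iff add.assoc bit_add_cancel)
  show "bij_betw ?\<phi> (null_space E (insert a (insert b S))) (null_space E (insert a S) \<times> UNIV)"
  proof (rule bij_betw_byWitness[where f' = ?\<psi>])
    show "\<forall>f\<in>null_space E (insert a (insert b S)). ?\<psi> (?\<phi> f) = f"
      using \<open>a \<noteq> b\<close> by (simp add: fun_eq_iff add.assoc bit_add_cancel)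
    show "\<forall>p\<in>null_space E (insert a S) \<times> UNIV. ?\<phi> (?\<psi> p) = p"
      using inv \<open>a \<noteq> b\<close> by simp
    show "?\<phi> ` null_space E (insert a (insert b S)) \<subseteq> null_space E (insert a S) \<times> UNIV"
      using \<open>a \<noteq> b\<close> by (auto simp: null_space_def rows)
    show "?\<psi> ` (null_space E (insert a S) \<times> UNIV) \<subseteq> null_space E (insert a (insert b S))"
    proof clarify
      fix f and c :: bit assume f: "f \<in> null_space E (insert a S)"
      have "row E (insert a (insert b S)) (f(a := f a + c, b := c)) v = row E (insert a S) f v"
        if "v \<in> insert a (insert b S)" for v
        using rows[OF that, of "f(a := f a + c, b := c)"] inv[OF f, of c] \<open>a \<noteq> b\<close> by simp
      then show "f(a := f a + c, b := c) \<in> null_space E (insert a (insert b S))"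
        using f row_b by (auto simp: null_space_def)
    qed
  qed
qed (use S in auto)

text \<open>A zero row and a zero column leave the coordinate at \<open>b\<close>
  unconstrained.\<close>

lemma nullity_isolated:
  assumes S: "finite S" "b \<notin> S"
    and b: "\<And>w. w \<in> insert b S \<Longrightarrow> \<not> E b w" "\<And>w. w \<in> insert b S \<Longrightarrow> \<not> E w b"
  shows "nullity E (insert b S) = Suc (nullity E S)"
proof (rule nullity_SucI)
  have row_b: "row E S f b = 0" for f
    unfolding row_def by (rule sum.neutral) (use b in auto)
  have rows: "row E (insert b S) f v = row E S f v" if "v \<in> insert b S" for f v
    using that S b by (simp add: row_insert)
  have inv: "f \<in> null_space E S \<Longrightarrow> f(b := 0) = f" for f
    using S by (auto simp: null_space_def fun_eq_iff)
  show "bij_betw (\<lambda>f. (f(b := 0), f b)) (null_space E (insert b S)) (null_space E S \<times> UNIV)"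
  proof (rule bij_betw_byWitness[where f' = "\<lambda>(f, c). f(b := c)"])
    show "(\<lambda>f. (f(b := 0), f b)) ` null_space E (insert b S) \<subseteq> null_space E S \<times> UNIV"
      using S by (auto simp: null_space_def rows row_upd)
    show "(\<lambda>(f, c). f(b := c)) ` (null_space E S \<times> UNIV) \<subseteq> null_space E (insert b S)"
      using S by (auto simp: null_space_def rows row_upd row_b)
  qed (auto simp: inv)
qed (use S in auto)

text \<open>The equation at \<open>b\<close> forces \<open>f a = 0\<close>, so a possible loop at
  \<open>a\<close> contributes nothing; the equation at \<open>a\<close> then determines
  \<open>f b\<close>, and the system on \<open>S\<close> is left.\<close>

lemma nullity_pendant:
  assumes S: "finite S" "a \<notin> S" "b \<notin> S" and "a \<noteq> b" "E a b" "E b a" "\<not> E b b"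
    and b: "\<And>w. w \<in> S \<Longrightarrow> \<not> E b w" "\<And>w. w \<in> S \<Longrightarrow> \<not> E w b"
  shows "nullity E (insert a (insert b S)) = nullity E S"
proof (rule nullity_eqI)
  have row_b: "row E S f b = 0" for f
    unfolding row_def by (rule sum.neutral) (use b in auto)
  have mem: "f \<in> null_space E (insert a (insert b S)) \<longleftrightarrow>
      f a = 0 \<and> f b = row E S f a \<and> (\<forall>v. v \<notin> insert a (insert b S) \<longrightarrow> f v = 0) \<and> (\<forall>v\<in>S. row E S f v = 0)" for f
    using assms(1-7) b(2) by (auto simp: null_space_def row_insert row_b bit_add_eq_0_iff)
  have mem': "f \<in> null_space E S \<Longrightarrow> f a = 0 \<and> f b = 0" for f
    using S by (simp add: null_space_def)
  show "bij_betw (\<lambda>f. f(b := 0)) (null_space E (insert a (insert b S))) (null_space E S)"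
  proof (rule bij_betw_byWitness[where f' = "\<lambda>f. f(b := row E S f a)"])
    show "\<forall>f\<in>null_space E (insert a (insert b S)). (f(b := 0))(b := row E S (f(b := 0)) a) = f"
      using S by (simp add: mem row_upd fun_upd_idem)
    show "\<forall>f\<in>null_space E S. (f(b := row E S f a))(b := 0) = f"
      using mem' by (simp add: fun_upd_idem)
    show "(\<lambda>f. f(b := 0)) ` null_space E (insert a (insert b S)) \<subseteq> null_space E S"
      using S by (auto simp: mem row_upd) (auto simp: null_space_def row_upd)
    show "(\<lambda>f. f(b := row E S f a)) ` null_space E S \<subseteq> null_space E (insert a (insert b S))"
      using S \<open>a \<noteq> b\<close> mem' by (auto simp: mem row_upd) (auto simp: null_space_def)
  qed
qed (use S in auto)

section \<open>Graph operations: adjacency, well-formedness, simplicity\<close>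

lemma verts_simps [simp]:
  "verts (del_vert G a) = verts G - {a}" "verts (local_comp G a) = verts G"
  "verts (pivot G a b) = verts G" "verts (reweight H a p q) = verts H"
  "adj (reweight H a p q) = adj H"
  by (simp_all add: del_vert_def induced_def local_comp_def pivot_def reweight_def)

lemma adj_del_vert:
  "adj (del_vert G a) u w \<longleftrightarrow> adj G u w \<and> u \<in> verts G - {a} \<and> w \<in> verts G - {a}"
  by (simp add: del_vert_def induced_def)

lemma adj_local_comp:
  "adj (local_comp G a) u w \<longleftrightarrow> adj G u w \<noteq> (u \<noteq> a \<and> w \<noteq> a \<and> adj G u a \<and> adj G w a)"
  by (simp add: local_comp_def)

text \<open>The two orders of \<open>pivot_pair\<close> merge into an exclusive or, the form of the
  update in the nullity lemmas for pivots.\<close>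

lemma adj_pivot:
  "adj (pivot G a b) u w \<longleftrightarrow> adj G u w \<noteq> (u \<notin> {a, b} \<and> w \<notin> {a, b} \<and>
     (adj G u a \<and> adj G w b) \<noteq> (adj G u b \<and> adj G w a))"
  by (auto simp: pivot_def pivot_pair_def)

lemma graphD:
  assumes "graph G"
  shows "finite (verts G)" "symp (adj G)" "adj G u w \<longleftrightarrow> adj G w u"
    and "adj G u w \<Longrightarrow> u \<in> verts G \<and> w \<in> verts G"
  using assms by (auto simp: graph_def symp_def)

lemma graph_del_vert: "graph G \<Longrightarrow> graph (del_vert G a)"
  by (auto simp: graph_def adj_del_vert)

lemma graph_local_comp: "graph G \<Longrightarrow> graph (local_comp G a)"
  unfolding graph_def adj_local_comp by auto

lemma graph_pivot: "graph G \<Longrightarrow> graph (pivot G a b)"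
  unfolding graph_def adj_pivot by auto

lemma graph_reweight: "graph (reweight G a p q) \<longleftrightarrow> graph G"
  by (simp add: graph_def)

lemma simple_del_vert: "simple G \<Longrightarrow> simple (del_vert G a)"
  by (simp add: simple_def adj_del_vert)

lemma simple_pivot: "simple G \<Longrightarrow> simple (pivot G a b)"
  by (auto simp: simple_def adj_pivot)

lemma simple_reweight: "simple (reweight G a p q) \<longleftrightarrow> simple G"
  by (simp add: simple_def)

section \<open>Recurrences for the vertex-nullity polynomial\<close>

abbreviation Y :: "int poly" where "Y \<equiv> [:0, 1:]"

lemma vertex_nullity_poly_alt:
  "vertex_nullity_poly G = (\<Sum>S\<in>Pow (verts G). (Y - 1) ^ nullity (adj G) S)"
  by (simp add: vertex_nullity_poly_def gf2_nullity_induced)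

lemma vertex_nullity_poly_cong:
  "verts G = verts H \<Longrightarrow> adj G = adj H \<Longrightarrow> vertex_nullity_poly G = vertex_nullity_poly H"
  by (simp add: vertex_nullity_poly_alt)

text \<open>Keeping \<open>adj G\<close> on the right puts all sums of a recurrence over the same
  relation.\<close>

lemma vertex_nullity_poly_del_vert:
  "vertex_nullity_poly (del_vert G a) = (\<Sum>S\<in>Pow (verts G - {a}). (Y - 1) ^ nullity (adj G) S)"
  unfolding vertex_nullity_poly_alt verts_simps
  by (intro sum.cong refl arg_cong2[where f = "(^)"] nullity_cong) (auto simp: adj_del_vert)

lemma vertex_nullity_poly_del_vert2:
  "vertex_nullity_poly (del_vert (del_vert G a) b) =
    (\<Sum>S\<in>Pow (verts G - {a} - {b}). (Y - 1) ^ nullity (adj G) S)"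
  unfolding vertex_nullity_poly_alt verts_simps
  by (intro sum.cong refl arg_cong2[where f = "(^)"] nullity_cong) (auto simp: adj_del_vert)

lemma sum_Pow_remove:
  fixes g :: "'a set \<Rightarrow> 'b::comm_monoid_add"
  assumes "finite A" "a \<in> A"
  shows "(\<Sum>S\<in>Pow A. g S) = (\<Sum>S\<in>Pow (A - {a}). g S + g (insert a S))"
proof -
  have "Pow A = Pow (A - {a}) \<union> insert a ` Pow (A - {a})"
    using Pow_insert[of a "A - {a}"] assms(2) by (simp add: insert_absorb)
  moreover have "Pow (A - {a}) \<inter> insert a ` Pow (A - {a}) = {}" by auto
  moreover have "inj_on (insert a) (Pow (A - {a}))" by (auto simp: inj_on_def)
  ultimately show ?thesis
    using assms(1) by (simp add: sum.union_disjoint sum.reindex sum.distrib)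
qed

text \<open>Subsets avoiding \<open>a\<close> give the first child; those containing
  \<open>a\<close> lose it under the local complement with unchanged nullity.\<close>

lemma vertex_nullity_poly_loop:
  assumes "graph G" "a \<in> verts G" "adj G a a"
  shows "vertex_nullity_poly G =
    vertex_nullity_poly (del_vert G a) + vertex_nullity_poly (del_vert (local_comp G a) a)"
proof -
  have "nullity (adj G) (insert a S) = nullity (adj (local_comp G a)) S" if "S \<in> Pow (verts G - {a})" for S
    by (rule nullity_local_comp)
      (use that assms(3) graphD(1,2)[OF assms(1)] in \<open>auto simp: adj_local_comp intro: finite_subset\<close>)
  then show ?thesis
    unfolding vertex_nullity_poly_del_vert vertex_nullity_poly_alt[of G]
    using assms graphD(1)[OF assms(1)]
    by (simp add: sum_Pow_remove[of "verts G" a] sum.distrib)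
qed

lemma vertex_nullity_poly_pivot:
  assumes "graph G" "adjacent_unlooped G a b"
  shows "vertex_nullity_poly G =
    vertex_nullity_poly (del_vert G a) + vertex_nullity_poly (del_vert (pivot G a b) b)"
proof -
  let ?W = "verts G - {a} - {b}" and ?E = "adj G" and ?E' = "adj (pivot G a b)"
  note G = graphD(1,2)[OF assms(1)]
  have ab: "a \<noteq> b" "?E a b" "\<not> ?E a a" "\<not> ?E b b" "a \<in> verts G" "b \<in> verts G"
    using assms(2) by (auto simp: adjacent_unlooped_def)
  have S: "finite S" "a \<notin> S" "b \<notin> S" if "S \<in> Pow ?W" for S
    using that G(1) by (auto intro: finite_subset)
  have both: "nullity ?E (insert a (insert b S)) = nullity ?E' S" if "S \<in> Pow ?W" for S
    by (rule nullity_pivot_both) (use S[OF that] G(2) ab in \<open>auto simp: adj_pivot\<close>)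
  have one: "nullity ?E (insert a S) = nullity ?E' (insert a S)" if "S \<in> Pow ?W" for S
    by (rule nullity_pivot_one[where b = b]) (use S[OF that] G(2) ab in \<open>auto simp: adj_pivot\<close>)
  have W: "verts G - {b} - {a} = ?W" by auto
  have "vertex_nullity_poly G = vertex_nullity_poly (del_vert G a) +
      (\<Sum>S\<in>Pow (verts G - {a}). (Y - 1) ^ nullity ?E (insert a S))"
    unfolding vertex_nullity_poly_del_vert vertex_nullity_poly_alt[of G]
    using G ab by (simp add: sum_Pow_remove[of "verts G" a] sum.distrib)
  also have "(\<Sum>S\<in>Pow (verts G - {a}). (Y - 1) ^ nullity ?E (insert a S)) =
      (\<Sum>S\<in>Pow ?W. (Y - 1) ^ nullity ?E (insert a S) + (Y - 1) ^ nullity ?E (insert a (insert b S)))"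
    by (rule sum_Pow_remove) (use G ab in auto)
  \<comment> \<open>Subsets of \<open>G\<close> with both \<open>a\<close> and \<open>b\<close> lose
    both in the pivot, those with \<open>a\<close> alone stay as they are. Together they run through
    all subsets of the pivot avoiding \<open>b\<close>.\<close>
  also have "\<dots> = (\<Sum>S\<in>Pow ?W. (Y - 1) ^ nullity ?E' S + (Y - 1) ^ nullity ?E' (insert a S))"
    by (rule sum.cong) (use both one in simp_all)
  also have "\<dots> = vertex_nullity_poly (del_vert (pivot G a b) b)"
    unfolding vertex_nullity_poly_del_vert W[symmetric] verts_simps
    by (rule sum_Pow_remove[symmetric]) (use G ab in auto)
  finally show ?thesis .
qed

lemma sum_Pow_remove2:
  fixes g :: "'a set \<Rightarrow> 'b::comm_monoid_add"
  assumes "finite A" "a \<in> A" "b \<in> A" "a \<noteq> b"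
  shows "(\<Sum>S\<in>Pow A. g S) =
    (\<Sum>S\<in>Pow (A - {b} - {a}). g S + g (insert a S) + g (insert b S) + g (insert a (insert b S)))"
proof -
  have "(\<Sum>S\<in>Pow A. g S) = (\<Sum>S\<in>Pow (A - {b}). g S + g (insert b S))"
    using assms by (intro sum_Pow_remove)
  also have "\<dots> = (\<Sum>S\<in>Pow (A - {b} - {a}). g S + g (insert b S) + (g (insert a S) + g (insert b (insert a S))))"
    using assms by (intro sum_Pow_remove) auto
  finally show ?thesis by (simp add: insert_commute ac_simps)
qed

lemma vertex_nullity_poly_twins:
  assumes "graph G" "identical_twins G a b"
  shows "vertex_nullity_poly G = vertex_nullity_poly (del_vert G b) +
    Y * (vertex_nullity_poly (del_vert G b) - vertex_nullity_poly (del_vert (del_vert G b) a))"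
proof -
  let ?W = "verts G - {b} - {a}" and ?n = "nullity (adj G)"
  note G = graphD(1,2)[OF assms(1)] and sym = graphD(3)[OF assms(1)]
  have ab: "a \<noteq> b" "a \<in> verts G" "b \<in> verts G" "adj G a a \<longleftrightarrow> adj G a b" "adj G b a \<longleftrightarrow> adj G a b"
      "adj G b b \<longleftrightarrow> adj G a b"
    using assms(2) sym by (auto simp: identical_twins_def)
  have adj: "adj G a w \<longleftrightarrow> adj G b w" "adj G w a \<longleftrightarrow> adj G w b" if "w \<in> ?W" for w
    using assms(2) sym that by (auto simp: identical_twins_def)
  have S: "finite S" "a \<notin> S" "b \<notin> S" if "S \<in> Pow ?W" for S
    using that G(1) by (auto intro: finite_subset)
  have swap: "?n (insert b S) = ?n (insert a S)" if "S \<in> Pow ?W" for S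
    by (rule nullity_twin_swap) (use S[OF that] that ab adj in auto)
  have both: "?n (insert a (insert b S)) = Suc (?n (insert a S))" if "S \<in> Pow ?W" for S
    by (rule nullity_twins) (use S[OF that] that ab adj in auto)
  have sub: "vertex_nullity_poly (del_vert G b) = (\<Sum>S\<in>Pow ?W. (Y - 1) ^ ?n S + (Y - 1) ^ ?n (insert a S))"
    unfolding vertex_nullity_poly_del_vert by (rule sum_Pow_remove) (use G ab in auto)
  have "vertex_nullity_poly G = (\<Sum>S\<in>Pow ?W. (Y - 1) ^ ?n S + (Y - 1) ^ ?n (insert a S)
      + (Y - 1) ^ ?n (insert b S) + (Y - 1) ^ ?n (insert a (insert b S)))"
    unfolding vertex_nullity_poly_alt by (rule sum_Pow_remove2) (use G ab in auto)
  \<comment> \<open>The sets with \<open>b\<close> contribute \<open>1 + (Y - 1) = Y\<close> times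
    the term of \<open>insert a S\<close>. Summed over \<open>S\<close>, these terms form the
    difference in the claim, which isolates the subsets containing \<open>a\<close>.\<close>
  also have "\<dots> = (\<Sum>S\<in>Pow ?W. (Y - 1) ^ ?n S + (Y - 1) ^ ?n (insert a S) + Y * (Y - 1) ^ ?n (insert a S))"
    by (rule sum.cong) (simp_all add: swap both algebra_simps del: mult_pCons_left mult_pCons_right)
  also have "\<dots> = vertex_nullity_poly (del_vert G b) +
      Y * (vertex_nullity_poly (del_vert G b) - vertex_nullity_poly (del_vert (del_vert G b) a))"
    unfolding sub vertex_nullity_poly_del_vert2
    by (simp add: sum.distrib sum_distrib_left del: mult_pCons_left mult_pCons_right)
  finally show ?thesis .
qed

lemma vertex_nullity_poly_pendant:
  assumes "graph G" "pendant G b a"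
  shows "vertex_nullity_poly G =
    vertex_nullity_poly (del_vert G b) + Y * vertex_nullity_poly (del_vert (del_vert G b) a)"
proof -
  let ?W = "verts G - {b} - {a}" and ?n = "nullity (adj G)"
  note G = graphD(1,2)[OF assms(1)] and sym = graphD(3)[OF assms(1)]
  have ab: "a \<in> verts G" "b \<in> verts G" "adj G b a" "\<not> adj G b b"
    and deg: "w \<noteq> a \<Longrightarrow> \<not> adj G b w" for w
    using assms(2) graphD(4)[OF assms(1)] by (auto simp: pendant_def)
  have deg': "w \<noteq> a \<Longrightarrow> \<not> adj G w b" for w
    using deg sym by metis
  have ab': "a \<noteq> b" "adj G a b" using ab sym by auto
  have S: "finite S" "a \<notin> S" "b \<notin> S" if "S \<in> Pow ?W" for S
    using that G(1) by (auto intro: finite_subset)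
  have one: "?n (insert b S) = Suc (?n S)" if "S \<in> Pow ?W" for S
    by (rule nullity_isolated) (use S[OF that] that ab deg deg' in auto)
  have both: "?n (insert a (insert b S)) = ?n S" if "S \<in> Pow ?W" for S
    by (rule nullity_pendant) (use S[OF that] that ab ab' deg deg' in auto)
  have sub: "vertex_nullity_poly (del_vert G b) = (\<Sum>S\<in>Pow ?W. (Y - 1) ^ ?n S + (Y - 1) ^ ?n (insert a S))"
    unfolding vertex_nullity_poly_del_vert by (rule sum_Pow_remove) (use G ab ab' in auto)
  have "vertex_nullity_poly G = (\<Sum>S\<in>Pow ?W. (Y - 1) ^ ?n S + (Y - 1) ^ ?n (insert a S)
      + (Y - 1) ^ ?n (insert b S) + (Y - 1) ^ ?n (insert a (insert b S)))"
    unfolding vertex_nullity_poly_alt by (rule sum_Pow_remove2) (use G ab ab' in auto)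
  \<comment> \<open>Adding \<open>b\<close> alone multiplies the term of \<open>S\<close> by
    \<open>Y - 1\<close>, adding \<open>a\<close> and \<open>b\<close> leaves it unchanged: together
    \<open>Y\<close> times that term.\<close>
  also have "\<dots> = (\<Sum>S\<in>Pow ?W. (Y - 1) ^ ?n S + (Y - 1) ^ ?n (insert a S) + Y * (Y - 1) ^ ?n S)"
    by (rule sum.cong) (simp_all add: one both algebra_simps del: mult_pCons_left mult_pCons_right)
  also have "\<dots> = vertex_nullity_poly (del_vert G b) + Y * vertex_nullity_poly (del_vert (del_vert G b) a)"
    unfolding sub vertex_nullity_poly_del_vert2
    by (simp add: sum.distrib sum_distrib_left del: mult_pCons_left mult_pCons_right)
  finally show ?thesis .
qed

lemma vertex_nullity_poly_edgeless:
  assumes "graph G" "edgeless G"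
  shows "vertex_nullity_poly G = Y ^ card (verts G)"
proof -
  have null: "nullity (adj G) S = card S" if "S \<subseteq> verts G" for S
  proof -
    have "finite S" using that graphD(1)[OF assms(1)] finite_subset by auto
    then show ?thesis using that
    proof (induction S)
      case empty
      show ?case by (simp add: nullity_empty)
    next
      case (insert v S)
      then have "nullity (adj G) (insert v S) = Suc (nullity (adj G) S)"
        by (intro nullity_isolated) (use assms(2) in \<open>auto simp: edgeless_def\<close>)
      with insert show ?case by simp
    qed
  qed
  \<comment> \<open>The binomial theorem for \<open>((Y - 1) + 1) ^ card A\<close>, summed over
    subsets.\<close>
  have "(\<Sum>S\<in>Pow A. (Y - 1) ^ card S) = Y ^ card A" if "finite A" for A :: "'a set"
    using that
  proof (induction A)
    case (insert a A)
    have "(\<Sum>S\<in>Pow (insert a A). (Y - 1) ^ card S) =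
        (\<Sum>S\<in>Pow A. (Y - 1) ^ card S + (Y - 1) ^ card (insert a S))"
      using sum_Pow_remove[of "insert a A" a "\<lambda>S. (Y - 1) ^ card S"] insert.hyps by simp
    also have "\<dots> = (\<Sum>S\<in>Pow A. Y * (Y - 1) ^ card S)"
    proof (rule sum.cong)
      fix S assume "S \<in> Pow A"
      then have "finite S" "a \<notin> S" using insert.hyps finite_subset by auto
      then show "(Y - 1) ^ card S + (Y - 1) ^ card (insert a S) = Y * (Y - 1) ^ card S"
        by (simp add: algebra_simps del: mult_pCons_left mult_pCons_right)
    qed simp
    finally show ?case
      using insert by (simp add: sum_distrib_left[symmetric] del: mult_pCons_left mult_pCons_right)
  qed simp
  then show ?thesis
    using null graphD(1)[OF assms(1)] by (simp add: vertex_nullity_poly_alt)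
qed

section \<open>Values of \<open>epsilon\<close> and \<open>gamma\<close>\<close>

lemma vertex_nullity_poly_reweight:
  "vertex_nullity_poly (reweight G a p q) = vertex_nullity_poly G"
  by (rule vertex_nullity_poly_cong) simp_all

lemma epsilon_reweight: "epsilon (reweight G a p q) = epsilon G"
  and gamma_reweight: "gamma (reweight G a p q) = gamma G"
  by (simp_all add: epsilon_def gamma_def vertex_nullity_poly_reweight)

lemma epsilon_pivot:
  "graph G \<Longrightarrow> adjacent_unlooped G a b \<Longrightarrow>
    epsilon G = epsilon (del_vert G a) + epsilon (del_vert (pivot G a b) b)"
  by (simp add: epsilon_def vertex_nullity_poly_pivot)

lemma gamma_pivot:
  "graph G \<Longrightarrow> adjacent_unlooped G a b \<Longrightarrow>
    gamma G = gamma (del_vert G a) + gamma (del_vert (pivot G a b) b)"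
  by (simp add: gamma_def vertex_nullity_poly_pivot)

lemma epsilon_edgeless:
  "graph G \<Longrightarrow> edgeless G \<Longrightarrow> epsilon G = of_bool (verts G = {})"
  by (auto simp: epsilon_def vertex_nullity_poly_edgeless poly_power power_0_left dest: graphD(1))

lemma gamma_edgeless:
  assumes "graph G" "edgeless G"
  shows "gamma G \<le> 1"
proof -
  have "coeff (Y ^ n) 1 \<le> (1 :: int)" for n
    using coeff_monom[of "1 :: int" n 1] by (simp add: monom_altdef)
  then show ?thesis
    using assms by (simp add: gamma_def vertex_nullity_poly_edgeless)
qed

text \<open>Induction on the number of vertices: an edge lets the pivot recurrence split
  \<open>epsilon\<close> over two smaller simple graphs, and an edgeless graph gives a positive
  power of \<open>Y\<close>, zero at 0.\<close>

lemma epsilon_simple_nonempty: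
  assumes "graph G" "simple G" "verts G \<noteq> {}"
  shows "epsilon G = 0"
  using assms
proof (induction "card (verts G)" arbitrary: G rule: less_induct)
  case less
  show ?case
  proof (cases "edgeless G")
    case True
    with less.prems show ?thesis by (simp add: epsilon_edgeless)
  next
    case False
    then obtain a b where ab: "a \<in> verts G" "b \<in> verts G" "adj G a b"
      by (auto simp: edgeless_def)
    with \<open>simple G\<close> have au: "adjacent_unlooped G a b"
      by (auto simp: adjacent_unlooped_def simple_def)
    have "card (verts G - {v}) < card (verts G)" if "v \<in> verts G" for v
      using that graphD(1)[OF \<open>graph G\<close>] by (rule_tac card_Diff1_less)
    \<comment> \<open>Each child keeps one end of the edge, so the induction hypothesis for nonempty
      graphs applies.\<close>
    moreover have "b \<in> verts G - {a}" "a \<in> verts G - {b}"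
      using au by (auto simp: adjacent_unlooped_def)
    ultimately have "epsilon (del_vert G a) = 0" "epsilon (del_vert (pivot G a b) b) = 0"
      using less.prems ab
      by (auto intro!: less.hyps simp: graph_del_vert graph_pivot simple_del_vert simple_pivot)
    then show ?thesis using epsilon_pivot[OF \<open>graph G\<close> au] by simp
  qed
qed

lemma epsilon_simple:
  assumes "graph G" "simple G"
  shows "epsilon G = of_bool (verts G = {})"
proof (cases "verts G = {}")
  case True
  then show ?thesis using epsilon_edgeless[OF assms(1)] by (simp add: edgeless_def)
next
  case False
  then show ?thesis using epsilon_simple_nonempty[OF assms] by simp
qed

section \<open>Leaf bounds by induction on computation trees\<close>

lemma leaves_pos: "computation_tree x y T \<Longrightarrow> 1 \<le> leaves T"
  by (induction rule: computation_tree.induct) auto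

lemma epsilon_le_leaves:
  assumes "computation_tree x y T" "graph (root T)"
  shows "epsilon (root T) \<le> int (leaves T)"
  using assms
proof (induction rule: computation_tree.induct)
  case (loop a H S T)
  then have "epsilon H = epsilon (root S) + epsilon (root T)"
    using vertex_nullity_poly_loop[of H a] by (simp add: epsilon_def)
  with loop show ?case by (simp add: graph_del_vert graph_local_comp)
next
  case (edge3 H a b S T U)
  \<comment> \<open>The coefficient of the third child vanishes when all weights and
    \<open>x - 1\<close> are 1; its subtree only adds leaves.\<close>
  then have "epsilon H = epsilon (root S) + epsilon (root T)"
    by (simp add: epsilon_pivot)
  with edge3 show ?case by (simp add: graph_del_vert graph_pivot)
next
  case (edge2 H a b S T)
  then have "epsilon H = epsilon (root S) + epsilon (root T)"
    by (simp add: epsilon_pivot epsilon_reweight)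
  with edge2 show ?case by (simp add: graph_del_vert graph_pivot graph_reweight)
next
  case (twins H a b T)
  then have "epsilon H = epsilon (root T)"
    using vertex_nullity_poly_twins[of H a b] by (simp add: epsilon_def vertex_nullity_poly_reweight)
  with twins show ?case by (simp add: graph_del_vert graph_reweight)
next
  case (pendant H b a T)
  then have "epsilon H = epsilon (root T)"
    using vertex_nullity_poly_pendant[of H b a] by (simp add: epsilon_def vertex_nullity_poly_reweight)
  with pendant show ?case by (simp add: graph_del_vert graph_reweight)
next
  case (leaf H)
  then show ?case by (simp add: epsilon_edgeless)
qed

text \<open>Deletions and pivots create no loops, so simplicity passes to all children and the loop
  rule never occurs.\<close>

lemma gamma_le_leaves:
  assumes "computation_tree x y T" "graph (root T)" "simple (root T)"
  shows "gamma (root T) \<le> 2 * int (leaves T)"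
  using assms
proof (induction rule: computation_tree.induct)
  case (loop a H S T)
  then show ?case by (simp add: simple_def)
next
  case (edge3 H a b S T U)
  then have "gamma H = gamma (root S) + gamma (root T)"
    by (simp add: gamma_pivot)
  with edge3 show ?case
    by (simp add: graph_del_vert graph_pivot simple_del_vert simple_pivot)
next
  case (edge2 H a b S T)
  then have "gamma H = gamma (root S) + gamma (root T)"
    by (simp add: gamma_pivot gamma_reweight)
  with edge2 show ?case
    by (simp add: graph_del_vert graph_pivot graph_reweight simple_del_vert simple_pivot simple_reweight)
next
  case (twins H a b T)
  let ?H = "del_vert H b"
  have gr: "graph ?H" "simple ?H" "graph (del_vert ?H a)" "simple (del_vert ?H a)"
    using twins.prems by (auto intro: graph_del_vert simple_del_vert)
  have "a \<in> verts ?H" using twins.hyps by (auto simp: identical_twins_def)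
  then have "epsilon ?H = 0" "0 \<le> epsilon (del_vert ?H a)"
    using gr by (auto simp: epsilon_simple_nonempty epsilon_simple)
  \<comment> \<open>The coefficient of \<open>y\<close> in \<open>Y * p\<close> is the constant term
    of \<open>p\<close>. As \<open>a\<close> survives in \<open>?H\<close>, the correction is at
    most 0.\<close>
  moreover have "gamma H = gamma (root T) + (epsilon ?H - epsilon (del_vert ?H a))"
    using vertex_nullity_poly_twins[of H a b] twins
    by (simp add: gamma_def epsilon_def poly_0_coeff_0 vertex_nullity_poly_reweight)
  ultimately show ?case
    using twins gr by (simp add: graph_reweight simple_reweight)
next
  case (pendant H b a T)
  let ?H = "del_vert H b"
  have gr: "graph ?H" "simple ?H" "graph (del_vert ?H a)" "simple (del_vert ?H a)"
    using pendant.prems by (auto intro: graph_del_vert simple_del_vert)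
  have "gamma H = gamma ?H + epsilon (del_vert ?H a)"
    using vertex_nullity_poly_pendant[of H b a] pendant
    by (simp add: gamma_def epsilon_def poly_0_coeff_0)
  also have "\<dots> \<le> 2 * int (leaves T)"
  \<comment> \<open>If only \<open>a\<close> remains after deleting \<open>b\<close>, both summands
    are at most 1 and the single guaranteed leaf pays for 2. Otherwise the second summand is
    0.\<close>
  proof (cases "verts (del_vert ?H a) = {}")
    case True
    then have "verts ?H \<subseteq> {a}" by auto
    then have "edgeless ?H"
      using gr(2) by (auto simp: edgeless_def simple_def)
    then have "gamma ?H \<le> 1" using gr(1) by (rule_tac gamma_edgeless)
    moreover have "epsilon (del_vert ?H a) \<le> 1"
      using gr by (simp add: epsilon_simple)
    ultimately show ?thesis
      using leaves_pos[OF pendant.hyps(2)] by simp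
  next
    case False
    then show ?thesis
      using pendant gr by (simp add: epsilon_simple_nonempty graph_reweight simple_reweight gamma_reweight)
  qed
  finally show ?case by simp
next
  case (leaf H)
  then have "gamma H \<le> 1" by (simp add: gamma_edgeless)
  then show ?case by simp
qed

theorem theorem5:
  fixes G :: "('v, 'r::{comm_ring, comm_monoid_mult}) wgraph"
    and x y :: 'r
    and T :: "('v, 'r) wgraph tree"
  assumes "graph G"
    and "computation_tree x y T"
    and "root T = G"
  shows "1 / 2 * real_of_int (epsilon G) \<le> real (leaves T)
    \<and> (simple G \<longrightarrow> 1 / 2 * real_of_int (gamma G) \<le> real (leaves T))"
proof -
  \<comment> \<open>Stronger than the claimed bound by a factor of two; the weaker form follows
    since leaf counts are nonnegative.\<close>
  have "epsilon G \<le> int (leaves T)"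
    using epsilon_le_leaves[OF assms(2)] assms by simp
  moreover have "simple G \<Longrightarrow> gamma G \<le> 2 * int (leaves T)"
    using gamma_le_leaves[OF assms(2)] assms by simp
  ultimately show ?thesis by auto
qed

end
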